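(* Let $X$ be a compact metric space with its Borel $\sigma$-algebra, $r:X\to X$ a measurable onto map with $\#r^{-1}(x)<\infty$ for all $x\in X$, $\mu$ a strongly $r$-invariant probability measure on $X$, and $m_0\in L^\infty(X)$. If $h\in L^1(X)$, $h\ge 0$ and $Rh=h$, then there exists a unique measure $\hat\mu$ on $X_\infty$ such that $$\hat\mu\circ\theta_n^{-1}=\omega_n\qquad(n\ge 0),$$ where $$\omega_n(f)=\int_X R^n(fh)\,\mathrm{d}\mu\qquad(f\in L^\infty(X)).$$
   Context: Strong $r$-invariance of $\mu$: $\int_X f\,\mathrm{d}\mu=\int_X\frac{1}{\#r^{-1}(x)}\sum_{r(y)=x}f(y)\,\mathrm{d}\mu(x)$ for all $f\in L^\infty(X)$. Here $L^p(X)=L^p(X,\mu)$. The operator $R=R_{m_0}$ is $(R\xi)(x)=\frac{1}{\#r^{-1}(x)}\sum_{r(y)=x}|m_0(y)|^2\xi(y)$ for $\xi\in L^1(X)$. The projective limit is $X_\infty=\{\hat x=(x_0,x_1,\dots)\in X^{\mathbb{N}_0} : r(x_{n+1})=x_n \text{ for all } n\ge 0\}$, with projections $\theta_n:X_\infty\to X$, $\theta_n(x_0,x_1,\dots)=x_n$, and with the $\sigma$-algebra generated by the sets $\theta_n^{-1}(E)$, $n\ge0$, $E\subset X$ Borel. Positive measures $\omega$ are identified with the functionals $f\mapsto\omega(f)=\int f\,\mathrm{d}\omega$; the equation $\hat\mu\circ\theta_n^{-1}=\omega_n$ means $\int_{X_\infty}f\circ\theta_n\,\mathrm{d}\hat\mu=\omega_n(f)$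 for all $f\in L^\infty(X)$. *)

theory Defs
  imports "HOL-Probability.Probability"
begin

definition fibre :: "'a set \<Rightarrow> ('a \<Rightarrow> 'a) \<Rightarrow> 'a \<Rightarrow> 'a set" where
  "fibre X r x = {y \<in> X. r y = x}"

(* Elements of L^1 and L^\<infinity> are represented by functions; equations and inequalities
   between them are read almost everywhere. *)
definition Linfty :: "'a measure \<Rightarrow> ('a \<Rightarrow> complex) set" where
  "Linfty M = {f \<in> borel_measurable M. \<exists>C. AE x in M. cmod (f x) \<le> C}"

(* The fibre average on the right need not be assumed integrable: the integral of a
   non-integrable function is 0, so for f \<ge> 0 the equation for f + 1 yields the
   integrability of the average of f + 1, hence of that of f. *)
definition strongly_invariant :: "'a set \<Rightarrow> ('a \<Rightarrow> 'a) \<Rightarrow> 'a measure \<Rightarrow> bool" where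
  "strongly_invariant X r M \<longleftrightarrow>
     (\<forall>f \<in> Linfty M.
        (\<integral>x. f x \<partial>M) = (\<integral>x. (\<Sum>y \<in> fibre X r x. f y) /\<^sub>R real (card (fibre X r x)) \<partial>M))"

(* Polymorphic in the codomain, so that it applies both to real h and to complex f h. *)
definition transfer_op ::
  "'a set \<Rightarrow> ('a \<Rightarrow> 'a) \<Rightarrow> ('a \<Rightarrow> complex) \<Rightarrow> ('a \<Rightarrow> 'b::real_vector) \<Rightarrow> 'a \<Rightarrow> 'b" where
  "transfer_op X r m0 \<xi> x =
     (\<Sum>y \<in> fibre X r x. (cmod (m0 y))\<^sup>2 *\<^sub>R \<xi> y) /\<^sub>R real (card (fibre X r x))"

definition proj_limit :: "'a set \<Rightarrow> ('a \<Rightarrow> 'a) \<Rightarrow> (nat \<Rightarrow> 'a) set" where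
  "proj_limit X r = {xs. \<forall>n. xs n \<in> X \<and> r (xs (Suc n)) = xs n}"

definition theta :: "nat \<Rightarrow> (nat \<Rightarrow> 'a) \<Rightarrow> 'a" where
  "theta n xs = xs n"

(* Only the space and the sigma-algebra of this measure matter. *)
definition proj_limit_algebra ::
  "'a::topological_space set \<Rightarrow> ('a \<Rightarrow> 'a) \<Rightarrow> (nat \<Rightarrow> 'a) measure" where
  "proj_limit_algebra X r =
     sigma (proj_limit X r)
       {theta n -` E \<inter> proj_limit X r | n E. E \<in> sets (restrict_space borel X)}"

definition omega ::
  "'a set \<Rightarrow> ('a \<Rightarrow> 'a) \<Rightarrow> 'a measure \<Rightarrow> ('a \<Rightarrow> complex) \<Rightarrow> ('a \<Rightarrow> real) \<Rightarrow> nat \<Rightarrow> ('a \<Rightarrow> complex) \<Rightarrow> complex" where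
  "omega X r M m0 h n f =
     (\<integral>x. (transfer_op X r m0 ^^ n) (\<lambda>y. f y * complex_of_real (h y)) x \<partial>M)"

end

theory Submission
  imports Defs
begin

text \<open>Strong invariance makes the uniform laws on the fibres of \<open>r\<close> a measurable Markov kernel that
  preserves \<open>\<mu>\<close>. By the pull-out rule for fibre averages, \<open>\<omega>\<^sub>n\<close> has density
  \<open>h(x) \<Prod>k<n. |m\<^sub>0(r\<^sup>k x)|\<^sup>2\<close> with respect to \<open>\<mu>\<close>. The harmonic function \<open>h\<close> turns
  the uniform kernel into the Markov kernel \<open>|m\<^sub>0(y)|\<^sup>2 h(y) / (#r\<^sup>-\<^sup>1(x) h(x))\<close> on the fibre of \<open>x\<close>,
  which carries \<open>\<omega>\<^sub>n\<close> to \<open>\<omega>\<^sub>(\<^sub>n\<^sub>+\<^sub>1\<^sub>)\<close>. The Ionescu-Tulcea theorem yields the path law of this chain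
  started in \<open>\<mu>\<close>; it is concentrated on the projective limit, and weighting it with \<open>h(x\<^sub>0)\<close> gives
  the desired measure. Uniqueness holds because the sets \<open>\<theta>\<^sub>n\<^sup>-\<^sup>1(E)\<close> are stable under
  intersection.\<close>

section \<open>Uniform fibre laws as a Markov kernel preserving \<mu>\<close>

locale strongly_invariant_map = prob_space \<mu>
  for X :: "'a::metric_space set" and r :: "'a \<Rightarrow> 'a" and \<mu> :: "'a measure" +
  assumes X_compact: "compact X"
    and r_meas': "r \<in> measurable (restrict_space borel X) (restrict_space borel X)"
    and r_onto: "r ` X = X"
    and finite_fibre: "x \<in> X \<Longrightarrow> finite (fibre X r x)"
    and sets_\<mu>: "sets \<mu> = sets (restrict_space borel X)"
    and invariant: "strongly_invariant X r \<mu>"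
begin

lemma space_\<mu>[simp]: "space \<mu> = X"
  using sets_eq_imp_space_eq[OF sets_\<mu>] by (simp add: space_restrict_space)

lemma r_measurable[measurable]: "r \<in> measurable \<mu> \<mu>"
  using r_meas' by (simp add: measurable_cong_sets[OF sets_\<mu> sets_\<mu>])

lemma r_in_X: "x \<in> X \<Longrightarrow> r x \<in> X"
  using r_onto by auto

lemma fibre_nonempty: "x \<in> X \<Longrightarrow> fibre X r x \<noteq> {}"
  using imageE[of x r X] by (auto simp: r_onto fibre_def)

lemma card_fibre_pos: "x \<in> X \<Longrightarrow> 0 < card (fibre X r x)"
  using finite_fibre fibre_nonempty by (simp add: card_gt_0_iff)

lemma singleton_measurable: "x \<in> X \<Longrightarrow> {x} \<in> sets \<mu>"
  by (auto simp: sets_\<mu> sets_restrict_space intro!: image_eqI[of _ _ "{x}"])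

definition avg :: "('a \<Rightarrow> 'b::real_vector) \<Rightarrow> 'a \<Rightarrow> 'b" where
  "avg g x = (\<Sum>y\<in>fibre X r x. g y) /\<^sub>R real (card (fibre X r x))"

text \<open>The uniform counting measure lives on the power set of the fibre. The image under the
  identity puts all these laws on the \<sigma>-algebra of \<mu>, as a kernel into
  \<open>subprob_algebra \<mu>\<close> requires.\<close>

definition unif :: "'a \<Rightarrow> 'a measure" where
  "unif x = distr (uniform_count_measure (fibre X r x)) \<mu> (\<lambda>y. y)"

lemma sets_unif[simp, measurable_cong]: "sets (unif x) = sets \<mu>"
  by (simp add: unif_def)

lemma space_unif[simp]: "space (unif x) = X"
  by (simp add: unif_def)

lemma id_measurable_fibre: "(\<lambda>y. y) \<in> measurable (uniform_count_measure (fibre X r x)) \<mu>"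
  by (auto simp: measurable_def space_uniform_count_measure sets_uniform_count_measure fibre_def)

lemma integral_unif:
  fixes f :: "'a \<Rightarrow> 'b::{banach, second_countable_topology}"
  assumes "x \<in> X" and [measurable]: "f \<in> borel_measurable \<mu>"
  shows "(\<integral>y. f y \<partial>unif x) = avg f x" "integrable (unif x) f"
proof -
  show "(\<integral>y. f y \<partial>unif x) = avg f x"
    unfolding unif_def avg_def using finite_fibre[OF assms(1)]
    by (subst integral_distr[OF id_measurable_fibre])
       (simp_all add: uniform_count_measure_def lebesgue_integral_point_measure_finite
          scaleR_sum_right inverse_eq_divide)
  show "integrable (unif x) f"
    unfolding unif_def using finite_fibre[OF assms(1)]
    by (subst integrable_distr_eq[OF id_measurable_fibre])
       (simp_all add: uniform_count_measure_def integrable_point_measure_finite)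
qed

lemma prob_space_unif: "x \<in> X \<Longrightarrow> prob_space (unif x)"
  unfolding unif_def using finite_fibre fibre_nonempty
  by (intro prob_space.prob_space_distr id_measurable_fibre prob_space_uniform_count_measure)

lemma emeasure_unif:
  assumes "x \<in> X" "A \<in> sets \<mu>"
  shows "emeasure (unif x) A = ennreal (avg (indicat_real A) x)"
proof -
  interpret u: prob_space "unif x" using prob_space_unif[OF assms(1)] .
  have "(\<integral>y. indicat_real A y \<partial>unif x) = measure (unif x) A"
    using assms sets.sets_into_space[OF assms(2)] by (simp add: Int_absorb2)
  then show ?thesis
    using integral_unif(1)[OF assms(1), of "indicat_real A"] assms(2)
    by (simp add: u.emeasure_eq_measure)
qed

lemma AE_unif_fibre:
  assumes "x \<in> X"
  shows "AE y in unif x. r y = x"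
proof -
  \<comment> \<open>Points are closed in a metric space, so fibres are measurable.\<close>
  have "{y \<in> space \<mu>. r y = x} = r -` {x} \<inter> space \<mu>" by auto
  also have "\<dots> \<in> sets \<mu>" using singleton_measurable[OF assms] by measurable
  finally show ?thesis
    unfolding unif_def
    by (subst AE_distr_iff[OF id_measurable_fibre])
       (auto intro: AE_I2 simp: space_uniform_count_measure fibre_def)
qed

text \<open>Applied to the indicator of \<open>A\<close>, both sides of strong invariance could be the junk value 0;
  adding 1 makes the left-hand side nonzero, which forces the average to be measurable.\<close>

lemma integrable_avg_indicator:
  assumes A[measurable]: "A \<in> sets \<mu>"
  shows "integrable \<mu> (avg (indicat_real A))" "(\<integral>x. avg (indicat_real A) x \<partial>\<mu>) = measure \<mu> A"
proof -
  let ?a = "avg (indicat_real A)"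
  have "(\<lambda>y. complex_of_real (indicat_real A y + 1)) \<in> Linfty \<mu>"
    unfolding Linfty_def
    by (auto intro!: exI[of _ 2] simp: norm_of_real simp del: of_real_add split: split_indicator)
  with invariant have "(\<integral>y. complex_of_real (indicat_real A y + 1) \<partial>\<mu>) =
     (\<integral>x. (\<Sum>y \<in> fibre X r x. complex_of_real (indicat_real A y + 1)) /\<^sub>R real (card (fibre X r x)) \<partial>\<mu>)"
    unfolding strongly_invariant_def by blast
  also have "\<dots> = (\<integral>x. complex_of_real (?a x + 1) \<partial>\<mu>)"
    using card_fibre_pos
    by (intro Bochner_Integration.integral_cong refl)
       (auto simp: avg_def sum.distrib scaleR_conv_of_real field_simps)
  finally have "(\<integral>y. indicat_real A y + 1 \<partial>\<mu>) = (\<integral>x. ?a x + 1 \<partial>\<mu>)"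
    by (simp only: integral_complex_of_real of_real_eq_iff)
  moreover have "(\<integral>y. indicat_real A y + 1 \<partial>\<mu>) = measure \<mu> A + 1"
    using sets.sets_into_space[OF A] prob_space
    by (subst Bochner_Integration.integral_add) (simp_all add: Int_absorb2 integrable_real_indicator emeasure_eq_measure)
  ultimately have *: "(\<integral>x. ?a x + 1 \<partial>\<mu>) = measure \<mu> A + 1" by simp
  then have "(\<integral>x. ?a x + 1 \<partial>\<mu>) \<noteq> 0"
    using measure_nonneg[of \<mu> A] by linarith
  then have "integrable \<mu> (\<lambda>x. ?a x + 1)"
    using not_integrable_integral_eq by blast
  from Bochner_Integration.integrable_diff[OF this integrable_const[of 1]]
  show i: "integrable \<mu> ?a" by simp
  have "(\<integral>x. ?a x + 1 \<partial>\<mu>) = (\<integral>x. ?a x \<partial>\<mu>) + 1"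
    using i prob_space by (subst Bochner_Integration.integral_add) simp_all
  with * show "(\<integral>x. ?a x \<partial>\<mu>) = measure \<mu> A" by simp
qed

lemma avg_indicator_nonneg: "0 \<le> avg (indicat_real A) x"
  unfolding avg_def by (intro scaleR_nonneg_nonneg sum_nonneg) simp_all

text \<open>Measurability in the base point comes from strong invariance: integrability of the
  averaged indicators includes their measurability.\<close>

lemma unif_measurable[measurable]: "unif \<in> measurable \<mu> (subprob_algebra \<mu>)"
proof (rule measurable_subprob_algebra)
  fix A assume A: "A \<in> sets \<mu>"
  then have "(\<lambda>x. ennreal (avg (indicat_real A) x)) \<in> borel_measurable \<mu>"
    using integrable_avg_indicator(1)[OF A] by simp
  then show "(\<lambda>x. emeasure (unif x) A) \<in> borel_measurable \<mu>"
    by (rule measurable_cong[THEN iffD1, rotated]) (simp add: emeasure_unif A)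
qed (auto intro: prob_space_imp_subprob_space prob_space_unif)

lemma bind_unif: "\<mu> \<bind> unif = \<mu>"
proof (rule measure_eqI)
  show "sets (\<mu> \<bind> unif) = sets \<mu>"
    using not_empty by (intro sets_bind) auto
  fix A assume "A \<in> sets (\<mu> \<bind> unif)"
  then have A: "A \<in> sets \<mu>"
    using not_empty by (subst (asm) sets_bind) auto
  have "emeasure (\<mu> \<bind> unif) A = (\<integral>\<^sup>+x. emeasure (unif x) A \<partial>\<mu>)"
    using not_empty A by (intro emeasure_bind) auto
  also have "\<dots> = (\<integral>\<^sup>+x. ennreal (avg (indicat_real A) x) \<partial>\<mu>)"
    by (intro nn_integral_cong) (simp add: emeasure_unif A)
  also have "\<dots> = emeasure \<mu> A"
    using nn_integral_eq_integral[OF integrable_avg_indicator(1)[OF A]]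
    by (simp add: avg_indicator_nonneg integrable_avg_indicator(2)[OF A] emeasure_eq_measure)
  finally show "emeasure (\<mu> \<bind> unif) A = emeasure \<mu> A" .
qed

lemma nn_integral_unif:
  assumes "f \<in> borel_measurable \<mu>"
  shows "(\<integral>\<^sup>+x. \<integral>\<^sup>+y. f y \<partial>unif x \<partial>\<mu>) = (\<integral>\<^sup>+x. f x \<partial>\<mu>)"
  using nn_integral_bind[OF assms unif_measurable] by (simp add: bind_unif)

text \<open>A \<mu>-null set \<open>N\<close> has average mass \<open>\<mu>(N) = 0\<close> under the
  fibre laws, hence mass 0 for almost every fibre. This carries the almost-everywhere hypotheses on
  \<open>h\<close> over to fibres.\<close>

lemma AE_unif:
  assumes "AE y in \<mu>. P y"
  shows "AE x in \<mu>. AE y in unif x. P y"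
proof -
  obtain N where N: "N \<in> null_sets \<mu>" "{y \<in> space \<mu>. \<not> P y} \<subseteq> N"
    using assms by (auto simp: eventually_ae_filter)
  have [measurable]: "N \<in> sets \<mu>" using N by auto
  have "(\<integral>\<^sup>+x. emeasure (unif x) N \<partial>\<mu>) = 0"
    using nn_integral_unif[of "indicator N"] N by (simp add: null_setsD1)
  then have "AE x in \<mu>. emeasure (unif x) N = 0"
    by (subst (asm) nn_integral_0_iff_AE)
       (simp_all add: measurable_compose[OF unif_measurable measurable_emeasure_subprob_algebra])
  then show ?thesis
    by eventually_elim (use N in \<open>auto simp: eventually_ae_filter null_sets_def intro!: exI[of _ N]\<close>)
qed

lemma avg_measurable[measurable]:
  fixes f :: "'a \<Rightarrow> 'b::{banach, second_countable_topology}"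
  assumes [measurable]: "f \<in> borel_measurable \<mu>"
  shows "avg f \<in> borel_measurable \<mu>"
proof -
  have "(\<lambda>x. \<integral>y. f y \<partial>unif x) \<in> borel_measurable \<mu>" by measurable
  then show ?thesis
    by (rule measurable_cong[THEN iffD1, rotated]) (simp add: integral_unif)
qed

lemma norm_avg_le: "norm (avg f x) \<le> avg (\<lambda>y. norm (f y)) x"
  by (auto simp: avg_def intro!: mult_left_mono norm_sum)

lemma integrable_avg_norm:
  fixes f :: "'a \<Rightarrow> 'b::{banach, second_countable_topology}"
  assumes f: "integrable \<mu> f"
  shows "integrable \<mu> (avg (\<lambda>y. norm (f y)))"
proof (rule integrableI_nonneg)
  have [measurable]: "f \<in> borel_measurable \<mu>" using f by auto
  show "avg (\<lambda>y. norm (f y)) \<in> borel_measurable \<mu>" by simp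
  have "(\<integral>\<^sup>+x. ennreal (avg (\<lambda>y. norm (f y)) x) \<partial>\<mu>) = (\<integral>\<^sup>+x. \<integral>\<^sup>+y. norm (f y) \<partial>unif x \<partial>\<mu>)"
    by (intro nn_integral_cong, subst nn_integral_eq_integral) (auto simp: integral_unif)
  also have "\<dots> < \<infinity>"
    using f by (subst nn_integral_unif) (auto simp: integrable_iff_bounded)
  finally show "(\<integral>\<^sup>+x. ennreal (avg (\<lambda>y. norm (f y)) x) \<partial>\<mu>) < \<infinity>" .
qed (auto simp: avg_def intro!: sum_nonneg AE_I2 mult_nonneg_nonneg)

lemma integrable_avg:
  fixes f :: "'a \<Rightarrow> 'b::{banach, second_countable_topology}"
  assumes f: "integrable \<mu> f"
  shows "integrable \<mu> (avg f)"
  by (rule Bochner_Integration.integrable_bound[OF integrable_avg_norm[OF f]])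
     (use f in \<open>auto intro!: AE_I2 order_trans[OF norm_avg_le]\<close>)

text \<open>Invariance extends from indicators to integrable functions by linearity and dominated
  convergence.\<close>

lemma integral_avg:
  fixes f :: "'a \<Rightarrow> 'b::{banach, second_countable_topology}"
  assumes "integrable \<mu> f"
  shows "(\<integral>x. avg f x \<partial>\<mu>) = (\<integral>x. f x \<partial>\<mu>)"
  using assms
proof (induction rule: integrable_induct)
  case (base A c)
  have "avg (\<lambda>x. indicat_real A x *\<^sub>R c) = (\<lambda>x. avg (indicat_real A) x *\<^sub>R c)"
    by (auto simp: avg_def fun_eq_iff scaleR_sum_left[symmetric])
  then show ?case
    using base sets.sets_into_space[OF base(1)] integrable_avg_indicator[OF base(1)]
    by (auto simp: Int_absorb2)
next
  case (add f g)
  have "avg (\<lambda>x. f x + g x) = (\<lambda>x. avg f x + avg g x)"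
    by (auto simp: avg_def fun_eq_iff sum.distrib scaleR_add_right)
  then show ?case
    using add by (simp add: integrable_avg)
next
  case (lim f s)
  have [measurable]: "f \<in> borel_measurable \<mu>" "\<And>i. s i \<in> borel_measurable \<mu>"
    using lim by auto
  have *: "(\<lambda>i. \<integral>x. s i x \<partial>\<mu>) \<longlonglongrightarrow> (\<integral>x. f x \<partial>\<mu>)"
    using lim by (intro integral_dominated_convergence[where w="\<lambda>x. 2 * norm (f x)"]) auto
  have "(\<lambda>i. \<integral>x. avg (s i) x \<partial>\<mu>) \<longlonglongrightarrow> (\<integral>x. avg f x \<partial>\<mu>)"
  \<comment> \<open>The induction rule supplies approximants bounded by
    \<open>2 * norm (f x)\<close>; averaging this bound gives an integrable majorant.\<close>
  proof (intro integral_dominated_convergence[where w="\<lambda>x. 2 * avg (\<lambda>y. norm (f y)) x"])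
    show "AE x in \<mu>. (\<lambda>i. avg (s i) x) \<longlonglongrightarrow> avg f x"
      unfolding avg_def using lim(2) by (auto intro!: AE_I2 tendsto_intros simp: fibre_def)
    show "AE x in \<mu>. norm (avg (s i) x) \<le> 2 * avg (\<lambda>y. norm (f y)) x" for i
    proof (rule AE_I2)
      fix x
      have "avg (\<lambda>y. norm (s i y)) x \<le> avg (\<lambda>y. 2 * norm (f y)) x"
        using lim(3) by (auto simp: avg_def fibre_def intro!: mult_left_mono sum_mono)
      with norm_avg_le[of "s i" x] show "norm (avg (s i) x) \<le> 2 * avg (\<lambda>y. norm (f y)) x"
        by (simp add: avg_def sum_distrib_left[symmetric])
    qed
  qed (use integrable_avg_norm[OF lim(4)] in auto)
  then have "(\<lambda>i. \<integral>x. s i x \<partial>\<mu>) \<longlonglongrightarrow> (\<integral>x. avg f x \<partial>\<mu>)"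
    by (simp add: lim)
  from LIMSEQ_unique[OF this *] show ?case .
qed

lemma integral_avg_pow:
  fixes f :: "'a \<Rightarrow> 'b::{banach, second_countable_topology}"
  assumes "integrable \<mu> f"
  shows "integrable \<mu> ((avg ^^ n) f)" "(\<integral>x. (avg ^^ n) f x \<partial>\<mu>) = (\<integral>x. f x \<partial>\<mu>)"
proof (induction n)
  case (Suc n)
  { case 1 with Suc show ?case by (simp add: integrable_avg) }
  { case 2 with Suc show ?case by (simp add: integral_avg) }
qed (use assms in auto)

section \<open>Iterates of the transfer operator and the density of \<open>omega\<close>\<close>

definition weight :: "('a \<Rightarrow> complex) \<Rightarrow> nat \<Rightarrow> 'a \<Rightarrow> real" where
  "weight m0 n x = (\<Prod>k<n. (cmod (m0 ((r ^^ k) x)))\<^sup>2)"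

lemma weight_nonneg: "0 \<le> weight m0 n x"
  by (auto simp: weight_def intro!: prod_nonneg)

text \<open>Splits off the start of the orbit instead of its end; this is the form in which a step
  from \<open>r x\<close> back to \<open>x\<close> changes the weight.\<close>

lemma weight_Suc: "weight m0 (Suc n) x = (cmod (m0 x))\<^sup>2 * weight m0 n (r x)"
  unfolding weight_def
  by (simp add: prod.lessThan_Suc_shift funpow_Suc_right del: funpow.simps(2) prod.lessThan_Suc)

lemma pow_r_measurable[measurable]: "(r ^^ n) \<in> measurable \<mu> \<mu>"
  by (induction n) auto

lemma weight_measurable[measurable]:
  "m0 \<in> borel_measurable \<mu> \<Longrightarrow> weight m0 n \<in> borel_measurable \<mu>"
  unfolding weight_def[abs_def]
  by (intro borel_measurable_prod
      measurable_compose[OF pow_r_measurable, where g="\<lambda>x. (cmod (m0 x))\<^sup>2"]) measurable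

text \<open>A function of \<open>r y\<close> is constant on each fibre of \<open>r\<close>.\<close>

lemma avg_pull_out: "avg (\<lambda>y. c (r y) *\<^sub>R f y) = (\<lambda>x. c x *\<^sub>R avg f x)"
  by (auto simp: avg_def fibre_def fun_eq_iff scaleR_sum_right mult.commute intro!: sum.cong)

lemma avg_pow_pull_out: "(avg ^^ n) (\<lambda>y. c ((r ^^ n) y) *\<^sub>R f y) = (\<lambda>x. c x *\<^sub>R (avg ^^ n) f x)"
proof (induction n arbitrary: f)
  case (Suc n)
  \<comment> \<open>The extra average is peeled off at the inner end, so the induction hypothesis is
    applied to \<open>avg f\<close>.\<close>
  have "(avg ^^ Suc n) (\<lambda>y. c ((r ^^ Suc n) y) *\<^sub>R f y) = (avg ^^ n) (avg (\<lambda>y. c ((r ^^ n) (r y)) *\<^sub>R f y))"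
    by (simp only: funpow_Suc_right o_def)
  also have "avg (\<lambda>y. c ((r ^^ n) (r y)) *\<^sub>R f y) = (\<lambda>x. c ((r ^^ n) x) *\<^sub>R avg f x)"
    by (rule avg_pull_out)
  also have "(avg ^^ n) \<dots> = (\<lambda>x. c x *\<^sub>R (avg ^^ n) (avg f) x)"
    by (rule Suc)
  finally show ?case by (simp only: funpow_Suc_right o_def)
qed simp

lemma transfer_op_eq_avg: "transfer_op X r m0 f = avg (\<lambda>y. (cmod (m0 y))\<^sup>2 *\<^sub>R f y)"
  by (auto simp: transfer_op_def avg_def)

text \<open>The factor of the outermost operator moves inside the \<open>n\<close> inner averages by
  the pull-out rule and becomes the last factor of the weight. Since averages preserve integrals,
  \<open>weight m0 n\<close> times \<open>h\<close> is then the density of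
  \<open>omega\<close>.\<close>

lemma transfer_op_pow: "(transfer_op X r m0 ^^ n) f = (avg ^^ n) (\<lambda>y. weight m0 n y *\<^sub>R f y)"
proof (induction n)
  case (Suc n)
  have "(transfer_op X r m0 ^^ Suc n) f = avg (\<lambda>y. (cmod (m0 y))\<^sup>2 *\<^sub>R (avg ^^ n) (\<lambda>y. weight m0 n y *\<^sub>R f y) y)"
    by (simp add: Suc transfer_op_eq_avg)
  also have "\<dots> = avg ((avg ^^ n) (\<lambda>y. (cmod (m0 ((r ^^ n) y)))\<^sup>2 *\<^sub>R weight m0 n y *\<^sub>R f y))"
    by (simp only: avg_pow_pull_out[where c="\<lambda>x. (cmod (m0 x))\<^sup>2"])
  finally show ?case by (simp add: weight_def mult.commute)
qed (simp add: weight_def)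

lemma omega_eq:
  assumes "integrable \<mu> (\<lambda>x. weight m0 n x *\<^sub>R (f x * complex_of_real (h x)))"
  shows "omega X r \<mu> m0 h n f = (\<integral>x. weight m0 n x *\<^sub>R (f x * complex_of_real (h x)) \<partial>\<mu>)"
  unfolding omega_def transfer_op_pow by (rule integral_avg_pow(2)[OF assms])

text \<open>Compactness gives finite nets of radius \<open>1 / Suc n\<close>. Two points differ iff
  some net ball contains the first but not the second, so the set is a countable union of measurable
  rectangles.\<close>

lemma not_fibre_measurable: "{p \<in> X \<times> X. r (snd p) \<noteq> fst p} \<in> sets (\<mu> \<Otimes>\<^sub>M \<mu>)"
proof -
  have "\<exists>k. finite k \<and> k \<subseteq> X \<and> X \<subseteq> (\<Union>x\<in>k. ball x (1 / real (Suc n)))" for n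
    using seq_compact_imp_totally_bounded[of X] X_compact compact_eq_seq_compact_metric[of X] by simp
  then obtain k where k: "\<And>n. finite (k n)" "\<And>n. X \<subseteq> (\<Union>x\<in>k n. ball x (1 / real (Suc n)))"
    by metis
  let ?A = "\<lambda>n c. ball c (1 / real (Suc n)) \<inter> X"
  have [measurable]: "?A n c \<in> sets \<mu>" for n c
    by (auto simp: sets_\<mu> sets_restrict_space)
  have "{p \<in> X \<times> X. r (snd p) \<noteq> fst p} =
     (\<Union>n. \<Union>c\<in>k n. {p \<in> space (\<mu> \<Otimes>\<^sub>M \<mu>). fst p \<in> ?A n c \<and> r (snd p) \<notin> ?A n c})"
  proof (intro equalityI subsetI)
    fix p assume "p \<in> {p \<in> X \<times> X. r (snd p) \<noteq> fst p}"
    then have p: "fst p \<in> X" "snd p \<in> X" "r (snd p) \<noteq> fst p" by auto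
    \<comment> \<open>A ball of radius below half the distance cannot contain both points.\<close>
    then obtain n where n: "1 / real (Suc n) < dist (fst p) (r (snd p)) / 2"
      using nat_approx_posE[of "dist (fst p) (r (snd p)) / 2"] by auto
    obtain c where c: "c \<in> k n" "dist c (fst p) < 1 / real (Suc n)"
      using k(2)[of n] p by auto
    have "\<not> dist c (r (snd p)) < 1 / real (Suc n)"
      using n c(2) dist_triangle3[of "fst p" "r (snd p)" c] by linarith
    then show "p \<in> (\<Union>n. \<Union>c\<in>k n. {p \<in> space (\<mu> \<Otimes>\<^sub>M \<mu>). fst p \<in> ?A n c \<and> r (snd p) \<notin> ?A n c})"
      using c p by (auto simp: space_pair_measure mem_Times_iff intro!: exI[of _ n] bexI[of _ c])
  qed (auto simp: space_pair_measure r_in_X)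
  also have "\<dots> \<in> sets (\<mu> \<Otimes>\<^sub>M \<mu>)"
    using k(1) by (intro sets.countable_UN' sets.countable_UN countable_finite image_subsetI sets.finite_UN) measurable
  finally show ?thesis .
qed

end


section \<open>Finite marginals of the Ionescu-Tulcea limit\<close>

lemma (in Ionescu_Tulcea) distr_lim_initial:
  "distr PF.lim (PiM {0..<n} M) (\<lambda>\<omega>. restrict \<omega> {0..<n}) = C 0 n (\<lambda>_. undefined)"
proof -
  \<comment> \<open>The marginal over an index set is defined through the least initial segment
    containing it, which here is the set itself.\<close>
  have n: "up_to {0..<n} = n"
    by (intro antisym, subst up_to_iff) (use up_to_less[of "{0..<n}" "n - 1"] in \<open>cases n; auto\<close>)+
  have u: "(\<lambda>_. undefined) \<in> space (PiM {0..<0} M)" by (simp add: space_PiM)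
  have "distr PF.lim (PiM {0..<n} M) (\<lambda>\<omega>. restrict \<omega> {0..<n})
      = distr (C 0 n (\<lambda>_. undefined)) (PiM {0..<n} M) (\<lambda>\<omega>. restrict \<omega> {0..<n})"
    by (subst distr_lim) (simp_all add: CI_def n)
  also have "\<dots> = C 0 n (\<lambda>_. undefined)"
    using distr_C[of n n "\<lambda>_. undefined" 0] u by simp
  finally show ?thesis .
qed

text \<open>Conditioning on the first \<open>n\<close> coordinates: the marginal on
  \<open>Suc n\<close> coordinates is the one on \<open>n\<close> coordinates followed by the kernel
  \<open>eP n\<close>, which appends a point drawn from \<open>P n\<close>.\<close>

lemma (in Ionescu_Tulcea) nn_integral_lim_Suc:
  assumes F[measurable]: "F \<in> borel_measurable (PiM {0..<Suc n} M)"
  shows "(\<integral>\<^sup>+\<omega>. F (restrict \<omega> {0..<Suc n}) \<partial>PF.lim) =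
    (\<integral>\<^sup>+\<omega>. \<integral>\<^sup>+x. F (fun_upd (restrict \<omega> {0..<n}) n x) \<partial>P n (restrict \<omega> {0..<n}) \<partial>PF.lim)"
proof -
  let ?C = "\<lambda>n. C 0 n (\<lambda>_. undefined)"
  have u: "(\<lambda>_. undefined) \<in> space (PiM {0..<0} M)" by (simp add: space_PiM)
  have R[measurable]: "(\<lambda>\<omega>. restrict \<omega> {0..<n}) \<in> measurable PF.lim (PiM {0..<n} M)" for n
    by (simp add: measurable_cong_sets[OF PF.sets_lim] measurable_restrict_subset)
  have "(\<integral>\<^sup>+\<omega>. F (restrict \<omega> {0..<Suc n}) \<partial>PF.lim) = (\<integral>\<^sup>+\<omega>. F \<omega> \<partial>?C (Suc n))"
    by (subst distr_lim_initial[symmetric], subst nn_integral_distr) auto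
  also have "\<dots> = (\<integral>\<^sup>+\<omega>. \<integral>\<^sup>+\<omega>'. F \<omega>' \<partial>eP n \<omega> \<partial>?C n)"
    using u by (simp, subst nn_integral_bind[where B="PiM {0..<Suc n} M"])
      (auto simp: measurable_cong_sets[OF sets_C])
  also have "\<dots> = (\<integral>\<^sup>+\<omega>. \<integral>\<^sup>+x. F (fun_upd \<omega> n x) \<partial>P n \<omega> \<partial>?C n)"
    using u by (intro nn_integral_cong nn_integral_eP) (auto simp: space_C)
  also have "\<dots> = (\<integral>\<^sup>+\<omega>. \<integral>\<^sup>+x. F (fun_upd (restrict \<omega> {0..<n}) n x) \<partial>P n (restrict \<omega> {0..<n}) \<partial>PF.lim)"
  proof -
    \<comment> \<open>Measurability in the history is available for \<open>eP n\<close> and passes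
      to \<open>P n\<close> because the integrals agree.\<close>
    have "(\<lambda>\<omega>. \<integral>\<^sup>+\<omega>'. F \<omega>' \<partial>eP n \<omega>) \<in> borel_measurable (PiM {0..<n} M)" by measurable
    then have "(\<lambda>\<omega>. \<integral>\<^sup>+x. F (fun_upd \<omega> n x) \<partial>P n \<omega>) \<in> borel_measurable (PiM {0..<n} M)"
      by (rule measurable_cong[THEN iffD1, rotated]) (simp add: nn_integral_eP)
    then show ?thesis
      by (subst distr_lim_initial[symmetric], subst nn_integral_distr) auto
  qed
  finally show ?thesis .
qed

lemma ennreal_mult_divide_cancel:
  fixes a b c :: ennreal
  assumes "a \<noteq> 0" "a \<noteq> \<infinity>"
  shows "a * (b / a * c) = b * c"
proof -
  have "a * (b / a) = b"
    using mult_divide_eq_ennreal[of a b] assms by (simp add: ennreal_times_divide mult.commute)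
  then show ?thesis by (simp add: mult.assoc[symmetric])
qed

section \<open>The Doob transform by \<open>h\<close> and the measures
  \<open>\<omega> n\<close>\<close>

locale harmonic_system = strongly_invariant_map X r \<mu>
  for X :: "'a::metric_space set" and r :: "'a \<Rightarrow> 'a" and \<mu> :: "'a measure" +
  fixes m0 :: "'a \<Rightarrow> complex" and h :: "'a \<Rightarrow> real"
  assumes m0_measurable[measurable]: "m0 \<in> borel_measurable \<mu>"
    and h_integrable: "integrable \<mu> h"
    and h_nonneg: "AE x in \<mu>. 0 \<le> h x"
    and h_harmonic: "AE x in \<mu>. transfer_op X r m0 h x = h x"
begin

lemma h_measurable[measurable]: "h \<in> borel_measurable \<mu>"
  using h_integrable by auto

definition G :: "'a \<Rightarrow> ennreal" where "G y = ennreal ((cmod (m0 y))\<^sup>2)"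
text \<open>Negative values become 0, so \<open>H\<close> is a finite nonnegative version of
  \<open>h\<close>, equal to it almost everywhere.\<close>

definition H :: "'a \<Rightarrow> ennreal" where "H y = ennreal (h y)"
definition RH :: "'a \<Rightarrow> ennreal" where "RH x = (\<integral>\<^sup>+y. G y * H y \<partial>unif x)"

lemma G_H_measurable[measurable]: "G \<in> borel_measurable \<mu>" "H \<in> borel_measurable \<mu>"
  unfolding G_def[abs_def] H_def[abs_def] by measurable

lemma RH_measurable[measurable]: "RH \<in> borel_measurable \<mu>"
  unfolding RH_def[abs_def] by measurable

lemma H_finite: "H x \<noteq> \<infinity>" by (simp add: H_def)

text \<open>For almost every \<open>x\<close>, \<open>h\<close> is nonnegative almost everywhere
  under \<open>unif x\<close>, so the nonnegative integral is the real fibre sum, and harmonicity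
  evaluates it.\<close>

lemma AE_RH: "AE x in \<mu>. RH x = H x"
  using AE_unif[OF h_nonneg] h_harmonic AE_space
proof eventually_elim
  case (elim x)
  then have x: "x \<in> X" by simp
  have "RH x = (\<integral>\<^sup>+y. ennreal ((cmod (m0 y))\<^sup>2 * h y) \<partial>unif x)"
    by (simp add: RH_def G_def H_def ennreal_mult')
  also have "\<dots> = ennreal (\<integral>y. (cmod (m0 y))\<^sup>2 * h y \<partial>unif x)"
    using elim(1) by (intro nn_integral_eq_integral integral_unif(2) x) auto
  also have "(\<integral>y. (cmod (m0 y))\<^sup>2 * h y \<partial>unif x) = h x"
    using elim(2) by (subst integral_unif(1)[OF x]) (auto simp: transfer_op_eq_avg)
  finally show ?case by (simp add: H_def)
qed

text \<open>The transition density of the Doob transform by \<open>h\<close>. Off the set where \<open>h\<close> is positive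
  and harmonic it is replaced by the uniform law on the fibre.\<close>

definition doob :: "'a \<Rightarrow> 'a \<Rightarrow> ennreal" where
  "doob x y = (if H x \<noteq> 0 \<and> RH x = H x then G y * H y / H x else 1)"

definition doob_kernel :: "'a \<Rightarrow> 'a measure" where
  "doob_kernel x = density (unif x) (doob x)"

lemma doob_measurable: "case_prod doob \<in> borel_measurable (\<mu> \<Otimes>\<^sub>M \<mu>)"
  unfolding doob_def[abs_def] by measurable

lemma doob_measurable_snd[measurable]: "doob x \<in> borel_measurable \<mu>"
  unfolding doob_def[abs_def] by measurable

lemma sets_doob_kernel[simp, measurable_cong]: "sets (doob_kernel x) = sets \<mu>"
  by (simp add: doob_kernel_def)

lemma space_doob_kernel[simp]: "space (doob_kernel x) = X"
  by (simp add: doob_kernel_def)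

lemma nn_integral_doob_kernel:
  assumes [measurable]: "f \<in> borel_measurable \<mu>"
  shows "(\<integral>\<^sup>+y. f y \<partial>doob_kernel x) = (\<integral>\<^sup>+y. doob x y * f y \<partial>unif x)"
  unfolding doob_kernel_def by (intro nn_integral_density) simp_all

text \<open>The mass is \<open>RH x / H x = 1\<close> in the first case of \<open>doob\<close> and
  that of \<open>unif x\<close> in the second. Ionescu-Tulcea needs mass 1 at every point, which is
  why \<open>doob\<close> has the second case.\<close>

lemma prob_space_doob_kernel:
  assumes x: "x \<in> X"
  shows "prob_space (doob_kernel x)"
proof
  interpret u: prob_space "unif x" using prob_space_unif[OF x] .
  have "emeasure (doob_kernel x) (space (doob_kernel x)) = (\<integral>\<^sup>+y. 1 \<partial>doob_kernel x)" by simp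
  also have "\<dots> = (\<integral>\<^sup>+y. doob x y \<partial>unif x)" by (subst nn_integral_doob_kernel) auto
  also have "\<dots> = 1"
  proof (cases "H x \<noteq> 0 \<and> RH x = H x")
    case True
    then have "(\<integral>\<^sup>+y. doob x y \<partial>unif x) = RH x / H x"
      by (simp add: doob_def nn_integral_divide RH_def[symmetric])
    with True H_finite[of x] show ?thesis by (simp add: ennreal_divide_self less_top)
  next
    case False
    then have "doob x y = 1" for y by (auto simp: doob_def)
    then show ?thesis using u.emeasure_space_1 by simp
  qed
  finally show "emeasure (doob_kernel x) (space (doob_kernel x)) = 1" .
qed

lemma doob_kernel_measurable[measurable]: "doob_kernel \<in> measurable \<mu> (subprob_algebra \<mu>)"
proof (rule measurable_subprob_algebra)
  fix A assume A[measurable]: "A \<in> sets \<mu>"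
  have "(\<lambda>x. \<integral>\<^sup>+y. doob x y * indicator A y \<partial>unif x) \<in> borel_measurable \<mu>"
    using measurable_compose[OF measurable_snd borel_measurable_indicator[OF A]] doob_measurable
    by (intro nn_integral_measurable_subprob_algebra2[OF _ unif_measurable])
       (simp add: split_beta' borel_measurable_times_ennreal)
  moreover have "emeasure (doob_kernel x) A = (\<integral>\<^sup>+y. doob x y * indicator A y \<partial>unif x)" for x
    unfolding doob_kernel_def by (intro emeasure_density) simp_all
  ultimately show "(\<lambda>x. emeasure (doob_kernel x) A) \<in> borel_measurable \<mu>" by simp
qed (auto intro: prob_space_imp_subprob_space prob_space_doob_kernel)

lemma AE_doob_kernel_fibre:
  assumes "x \<in> X"
  shows "AE y in doob_kernel x. r y = x"
  unfolding doob_kernel_def using AE_unif_fibre[OF assms] by (subst AE_density) auto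

text \<open>Where \<open>H x\<close> is nonzero, it cancels the denominator of \<open>doob\<close>.
  Where it is 0, harmonicity makes \<open>G * H\<close> vanish almost everywhere under
  \<open>unif x\<close>, so the replacement law does no harm.\<close>

lemma H_nn_integral_doob_kernel:
  assumes x: "RH x = H x" and [measurable]: "f \<in> borel_measurable \<mu>"
  shows "H x * (\<integral>\<^sup>+y. f y \<partial>doob_kernel x) = (\<integral>\<^sup>+y. G y * H y * f y \<partial>unif x)"
proof (cases "H x = 0")
  case True
  then have "(\<integral>\<^sup>+y. G y * H y \<partial>unif x) = 0" using x by (simp add: RH_def)
  then have "AE y in unif x. G y * H y = 0" by (subst (asm) nn_integral_0_iff_AE) auto
  then have "AE y in unif x. G y * H y * f y = 0" by eventually_elim simp
  then have "(\<integral>\<^sup>+y. G y * H y * f y \<partial>unif x) = 0" by (subst nn_integral_0_iff_AE) auto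
  with True show ?thesis by simp
next
  case False
  then have "H x * (\<integral>\<^sup>+y. f y \<partial>doob_kernel x) = (\<integral>\<^sup>+y. H x * (G y * H y / H x * f y) \<partial>unif x)"
    using x by (simp add: nn_integral_doob_kernel doob_def nn_integral_cmult)
  also have "\<dots> = (\<integral>\<^sup>+y. G y * H y * f y \<partial>unif x)"
    using False H_finite[of x]
    by (intro nn_integral_cong ennreal_mult_divide_cancel) simp_all
  finally show ?thesis .
qed

definition \<omega> :: "nat \<Rightarrow> 'a measure" where
  "\<omega> n = density \<mu> (\<lambda>x. ennreal (weight m0 n x) * H x)"

lemma sets_\<omega>[simp, measurable_cong]: "sets (\<omega> n) = sets \<mu>"
  by (simp add: \<omega>_def)

lemma space_\<omega>[simp]: "space (\<omega> n) = X"
  by (simp add: \<omega>_def)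

text \<open>The factor \<open>H x\<close> in the density of \<open>\<omega> n\<close> turns the Doob
  kernel into \<open>G * H\<close> times the uniform law; invariance of \<mu> then collapses the
  double integral.\<close>

lemma nn_integral_\<omega>_Suc:
  assumes [measurable]: "f \<in> borel_measurable \<mu>"
  shows "(\<integral>\<^sup>+x. \<integral>\<^sup>+y. f y \<partial>doob_kernel x \<partial>\<omega> n) = (\<integral>\<^sup>+x. f x \<partial>\<omega> (Suc n))"
proof -
  let ?W = "\<lambda>n x. ennreal (weight m0 n x)"
  have "(\<integral>\<^sup>+x. \<integral>\<^sup>+y. f y \<partial>doob_kernel x \<partial>\<omega> n) = (\<integral>\<^sup>+x. ?W n x * (H x * \<integral>\<^sup>+y. f y \<partial>doob_kernel x) \<partial>\<mu>)"
    unfolding \<omega>_def by (subst nn_integral_density) (auto simp: mult.assoc)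
  also have "\<dots> = (\<integral>\<^sup>+x. \<integral>\<^sup>+y. ?W n (r y) * (G y * H y * f y) \<partial>unif x \<partial>\<mu>)"
  proof (rule nn_integral_cong_AE, use AE_RH AE_space in eventually_elim)
    case (elim x)
    then have x: "x \<in> X" by simp
    have "?W n x * (H x * \<integral>\<^sup>+y. f y \<partial>doob_kernel x) = (\<integral>\<^sup>+y. ?W n x * (G y * H y * f y) \<partial>unif x)"
      by (simp add: H_nn_integral_doob_kernel elim nn_integral_cmult)
    \<comment> \<open>The law \<open>unif x\<close> sits on the fibre of \<open>x\<close>, so the
      weight becomes a function of the integration variable.\<close>
    also have "\<dots> = (\<integral>\<^sup>+y. ?W n (r y) * (G y * H y * f y) \<partial>unif x)"
      using AE_unif_fibre[OF x] by (intro nn_integral_cong_AE) auto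
    finally show ?case .
  qed
  also have "\<dots> = (\<integral>\<^sup>+x. ?W n (r x) * (G x * H x * f x) \<partial>\<mu>)"
    by (intro nn_integral_unif) measurable
  also have "\<dots> = (\<integral>\<^sup>+x. ?W (Suc n) x * H x * f x \<partial>\<mu>)"
    by (intro nn_integral_cong) (simp add: weight_Suc G_def ennreal_mult weight_nonneg ac_simps)
  also have "\<dots> = (\<integral>\<^sup>+x. f x \<partial>\<omega> (Suc n))"
    unfolding \<omega>_def by (subst nn_integral_density) auto
  finally show ?thesis .
qed

lemma emeasure_space_\<omega>: "emeasure (\<omega> n) (space (\<omega> n)) = (\<integral>\<^sup>+x. ennreal (weight m0 n x) * H x \<partial>\<mu>)"
proof -
  have "emeasure (\<omega> n) (space (\<omega> n)) = (\<integral>\<^sup>+x. 1 \<partial>\<omega> n)" by simp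
  also have "\<dots> = (\<integral>\<^sup>+x. ennreal (weight m0 n x) * H x * 1 \<partial>\<mu>)"
    unfolding \<omega>_def by (intro nn_integral_density) measurable
  finally show ?thesis by simp
qed

text \<open>The mass of \<open>\<omega> 0\<close> is the integral of \<open>h\<close>, and the
  Markov kernel keeps it constant in \<open>n\<close>.\<close>

lemma finite_\<omega>: "finite_measure (\<omega> n)"
proof
  show "emeasure (\<omega> n) (space (\<omega> n)) \<noteq> \<infinity>"
  proof (induction n)
    case 0
    have "emeasure (\<omega> 0) (space (\<omega> 0)) = (\<integral>\<^sup>+x. ennreal (h x) \<partial>\<mu>)"
      unfolding emeasure_space_\<omega> by (simp add: weight_def H_def)
    also have "\<dots> < \<infinity>"
      using h_integrable h_nonneg by (subst nn_integral_eq_integral) auto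
    finally show ?case by simp
  next
    case (Suc n)
    have "emeasure (\<omega> (Suc n)) (space (\<omega> (Suc n))) = (\<integral>\<^sup>+x. \<integral>\<^sup>+y. 1 \<partial>doob_kernel x \<partial>\<omega> n)"
      by (subst nn_integral_\<omega>_Suc) auto
    also have "\<dots> = (\<integral>\<^sup>+x. 1 \<partial>\<omega> n)"
      by (intro nn_integral_cong) (simp add: prob_space.emeasure_space_1[OF prob_space_doob_kernel, simplified])
    finally show ?case using Suc by simp
  qed
qed

section \<open>The Markov chain with the Doob kernel\<close>

definition P :: "nat \<Rightarrow> (nat \<Rightarrow> 'a) \<Rightarrow> 'a measure" where
  "P n xs = (case n of 0 \<Rightarrow> \<mu> | Suc k \<Rightarrow> doob_kernel (xs k))"

lemma P_measurable: "P i \<in> measurable (PiM {0..<i} (\<lambda>_. \<mu>)) (subprob_algebra \<mu>)"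
proof (cases i)
  case 0
  then show ?thesis
    using prob_space_axioms prob_space_imp_subprob_space[of \<mu>]
    by (auto simp: P_def[abs_def] space_subprob_algebra intro!: measurable_const)
next
  case (Suc k)
  then show ?thesis
    unfolding P_def[abs_def]
    by (auto intro!: measurable_compose[OF _ doob_kernel_measurable] measurable_component_singleton)
qed

lemma prob_space_P: "x \<in> space (PiM {0..<i} (\<lambda>_. \<mu>)) \<Longrightarrow> prob_space (P i x)"
  using prob_space_axioms by (cases i) (auto simp: P_def space_PiM intro!: prob_space_doob_kernel)

sublocale IT: Ionescu_Tulcea P "\<lambda>_. \<mu>"
  by (intro Ionescu_Tulcea.intro P_measurable prob_space_P)

text \<open>The chain starts in the probability \<mu>, since \<open>\<omega> 0\<close> need not have
  mass 1; the density \<open>H\<close> of the initial state enters later, in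
  \<open>path_measure\<close>.\<close>

definition chain :: "(nat \<Rightarrow> 'a) measure" where "chain = IT.PF.lim"

lemma sets_chain[measurable_cong]: "sets chain = sets (PiM UNIV (\<lambda>_. \<mu>))"
  by (simp add: chain_def)

lemma space_chain: "space chain = {xs. \<forall>n. xs n \<in> X}"
  using sets_eq_imp_space_eq[OF sets_chain] by (auto simp: space_PiM)

text \<open>The integrand keeps the whole past so that it can involve both the initial weight
  \<open>H (xs 0)\<close> and the relation of \<open>xs (Suc n)\<close> to
  \<open>xs n\<close>.\<close>

lemma nn_integral_chain_Suc:
  assumes [measurable]: "case_prod f \<in> borel_measurable (PiM {0..n} (\<lambda>_. \<mu>) \<Otimes>\<^sub>M \<mu>)"
  shows "(\<integral>\<^sup>+xs. f (restrict xs {0..n}) (xs (Suc n)) \<partial>chain) = (\<integral>\<^sup>+xs. \<integral>\<^sup>+y. f (restrict xs {0..n}) y \<partial>doob_kernel (xs n) \<partial>chain)"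
proof -
  let ?F = "\<lambda>xs. f (restrict xs {0..n}) (xs (Suc n))"
  have F: "?F \<in> borel_measurable (PiM {0..<Suc (Suc n)} (\<lambda>_. \<mu>))"
  proof -
    have "(\<lambda>xs. (restrict xs {0..n}, xs (Suc n))) \<in>
      measurable (PiM {0..<Suc (Suc n)} (\<lambda>_. \<mu>)) (PiM {0..n} (\<lambda>_. \<mu>) \<Otimes>\<^sub>M \<mu>)"
      by (intro measurable_Pair measurable_restrict_subset measurable_component_singleton) auto
    from measurable_compose[OF this assms] show ?thesis by simp
  qed
  have "{0..<Suc (Suc n)} \<inter> {0..n} = {0..n}" "{0..<Suc n} \<inter> {0..n} = {0..n}" by auto
  with IT.nn_integral_lim_Suc[OF F] show ?thesis
    by (simp add: chain_def[symmetric] P_def)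
qed

end


section \<open>The \<sigma>-algebra of the projective limit and uniqueness\<close>

lemma space_proj_limit_algebra[simp]: "space (proj_limit_algebra X r) = proj_limit X r"
  by (auto simp: proj_limit_algebra_def space_measure_of_conv)

context strongly_invariant_map
begin

definition cylinders :: "(nat \<Rightarrow> 'a) set set" where
  "cylinders = {theta n -` E \<inter> proj_limit X r | n E. E \<in> sets \<mu>}"

lemma sets_proj_limit_algebra: "sets (proj_limit_algebra X r) = sigma_sets (proj_limit X r) cylinders"
  unfolding proj_limit_algebra_def cylinders_def sets_\<mu> by (intro sets_measure_of) auto

lemma theta_measurable[measurable]: "theta n \<in> measurable (proj_limit_algebra X r) \<mu>"
proof (rule measurableI)
  show "theta n -` A \<inter> space (proj_limit_algebra X r) \<in> sets (proj_limit_algebra X r)" if "A \<in> sets \<mu>" for A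
    using that unfolding sets_proj_limit_algebra
    by (intro sigma_sets.Basic) (auto simp: cylinders_def)
qed (auto simp: proj_limit_def theta_def)

lemma proj_limit_pow:
  assumes "xs \<in> proj_limit X r"
  shows "(r ^^ k) (xs (n + k)) = xs n"
proof (induction k)
  case (Suc k)
  have "r (xs (Suc (n + k))) = xs (n + k)" using assms by (simp add: proj_limit_def)
  with Suc show ?case by (simp add: funpow_Suc_right del: funpow.simps)
qed simp

text \<open>The earlier coordinate is the image of the later one under a power of \<open>r\<close>,
  so both conditions can be put on the later coordinate.\<close>

lemma Int_cylinders_le:
  assumes "n \<le> m" "E \<in> sets \<mu>" "F \<in> sets \<mu>"
  shows "(theta n -` E \<inter> proj_limit X r) \<inter> (theta m -` F \<inter> proj_limit X r) \<in> cylinders"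
proof -
  have "(r ^^ (m - n)) -` E \<inter> space \<mu> \<inter> F \<in> sets \<mu>"
    using assms measurable_sets[OF pow_r_measurable] by blast
  moreover have "(theta n -` E \<inter> proj_limit X r) \<inter> (theta m -` F \<inter> proj_limit X r)
      = theta m -` ((r ^^ (m - n)) -` E \<inter> space \<mu> \<inter> F) \<inter> proj_limit X r"
    using proj_limit_pow[of _ "m - n" n] \<open>n \<le> m\<close>
    by (auto simp: theta_def proj_limit_def)
  ultimately show ?thesis unfolding cylinders_def by blast
qed

lemma Int_stable_cylinders: "Int_stable cylinders"
proof (rule Int_stableI)
  fix A B assume "A \<in> cylinders" "B \<in> cylinders"
  then obtain n E m F where *: "A = theta n -` E \<inter> proj_limit X r" "E \<in> sets \<mu>"
      "B = theta m -` F \<inter> proj_limit X r" "F \<in> sets \<mu>"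
    unfolding cylinders_def by blast
  show "A \<inter> B \<in> cylinders"
    using Int_cylinders_le[of n m E F] Int_cylinders_le[of m n F E] * nat_le_linear[of n m]
    by (auto simp: Int_commute)
qed

lemma proj_limit_measure_eqI:
  assumes sets: "sets M = sets (proj_limit_algebra X r)" "sets N = sets (proj_limit_algebra X r)"
    and fin: "emeasure M (proj_limit X r) \<noteq> \<infinity>"
    and eq: "\<And>n E. E \<in> sets \<mu> \<Longrightarrow>
      emeasure M (theta n -` E \<inter> proj_limit X r) = emeasure N (theta n -` E \<inter> proj_limit X r)"
  shows "M = N"
proof (rule measure_eqI_generator_eq[OF Int_stable_cylinders, where \<Omega>="proj_limit X r" and A="\<lambda>_. proj_limit X r"])
  \<comment> \<open>The whole space is a cylinder, so the constant sequence serves as the exhaustion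
    in the uniqueness theorem.\<close>
  have "theta 0 -` space \<mu> \<inter> proj_limit X r = proj_limit X r"
    by (auto simp: theta_def proj_limit_def)
  then show "range (\<lambda>_::nat. proj_limit X r) \<subseteq> cylinders"
    unfolding cylinders_def by (auto intro!: exI[of _ "0::nat"] exI[of _ "space \<mu>"] simp del: space_\<mu>)
qed (use assms in \<open>auto simp: cylinders_def sets_proj_limit_algebra\<close>)

text \<open>Integrability of the indicator forces finite mass, so the complex integral determines
  the extended measure.\<close>

lemma emeasure_cylinder:
  assumes sets: "sets M = sets (proj_limit_algebra X r)" and E[measurable]: "E \<in> sets \<mu>"
    and "has_bochner_integral M (\<lambda>xs. indicator E (theta n xs) :: complex) c"
  shows "emeasure M (theta n -` E \<inter> proj_limit X r) = ennreal (Re c)"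
proof -
  let ?B = "theta n -` E \<inter> proj_limit X r"
  have space: "space M = proj_limit X r" using sets_eq_imp_space_eq[OF sets] by simp
  have B: "?B \<in> sets M"
    using measurable_sets[OF theta_measurable E, of n] by (simp add: sets)
  have "has_bochner_integral M (\<lambda>xs. Re (indicator E (theta n xs))) (Re c)"
    using assms(3) by (rule has_bochner_integral_bounded_linear[OF bounded_linear_Re])
  moreover have "Re (indicator E (theta n xs)) = indicat_real ?B xs" if "xs \<in> space M" for xs
    using that by (auto simp: space split: split_indicator)
  ultimately have *: "has_bochner_integral M (indicat_real ?B) (Re c)"
    by (simp cong: has_bochner_integral_cong)
  then have "integrable M (indicat_real ?B)" "Re c = measure M ?B"
    using B sets.sets_into_space[OF B] by (auto simp: has_bochner_integral_iff Int_absorb2)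
  moreover from this(1) have "emeasure M ?B < \<infinity>"
    using B sets.sets_into_space[OF B] by (simp add: integrable_indicator_iff Int_absorb2)
  ultimately show ?thesis by (simp add: emeasure_eq_ennreal_measure less_top)
qed

lemma indicator_Linfty: "E \<in> sets \<mu> \<Longrightarrow> (indicator E :: _ \<Rightarrow> complex) \<in> Linfty \<mu>"
  by (auto simp: Linfty_def intro!: exI[of _ 1] split: split_indicator)

lemma proj_limit_measure_unique:
  assumes "sets M = sets (proj_limit_algebra X r)" "sets N = sets (proj_limit_algebra X r)"
    and "\<And>n f. f \<in> Linfty \<mu> \<Longrightarrow> has_bochner_integral M (\<lambda>xs. f (theta n xs)) (I n f)"
    and "\<And>n f. f \<in> Linfty \<mu> \<Longrightarrow> has_bochner_integral N (\<lambda>xs. f (theta n xs)) (I n f)"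
  shows "M = N"
proof (rule proj_limit_measure_eqI[OF assms(1,2)])
  have e: "emeasure M (theta n -` E \<inter> proj_limit X r) = ennreal (Re (I n (indicator E)))"
    "emeasure N (theta n -` E \<inter> proj_limit X r) = ennreal (Re (I n (indicator E)))"
    if "E \<in> sets \<mu>" for n E
    using emeasure_cylinder[OF assms(1) that assms(3)[OF indicator_Linfty[OF that]]]
      emeasure_cylinder[OF assms(2) that assms(4)[OF indicator_Linfty[OF that]]] by simp_all
  show "emeasure M (theta n -` E \<inter> proj_limit X r) = emeasure N (theta n -` E \<inter> proj_limit X r)"
    if "E \<in> sets \<mu>" for n E using e[OF that] by simp
  have "theta 0 -` X \<inter> proj_limit X r = proj_limit X r"
    by (auto simp: theta_def proj_limit_def)
  then show "emeasure M (proj_limit X r) \<noteq> \<infinity>"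
    using e(1)[of X 0] sets.top[of \<mu>] by simp
qed

end

section \<open>Concentration of the chain on the projective limit, and existence\<close>

context harmonic_system
begin

text \<open>The marginal over no coordinates is a probability measure, and image measures keep total
  mass.\<close>

lemma prob_space_chain: "prob_space chain"
proof
  have "prob_space (IT.C 0 0 (\<lambda>_. undefined))"
    by (intro IT.prob_space_C) (simp add: space_PiM)
  then have "prob_space (distr chain (PiM {0..<0} (\<lambda>_. \<mu>)) (\<lambda>xs. restrict xs {0..<0}))"
    by (simp only: IT.distr_lim_initial chain_def)
  then have "prob_space chain"
    by (rule prob_space_distrD[rotated])
       (simp add: measurable_cong_sets[OF sets_chain] measurable_restrict_subset)
  then show "emeasure chain (space chain) = 1" by (rule prob_space.emeasure_space_1)
qed

lemma component_chain_measurable[measurable]: "(\<lambda>xs. xs n) \<in> measurable chain \<mu>"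
  by (simp add: measurable_cong_sets[OF sets_chain] measurable_component_singleton)

lemma nn_integral_chain_0:
  assumes [measurable]: "f \<in> borel_measurable \<mu>"
  shows "(\<integral>\<^sup>+xs. f (xs 0) \<partial>chain) = (\<integral>\<^sup>+x. f x \<partial>\<mu>)"
proof -
  have "(\<lambda>xs. f (xs 0)) \<in> borel_measurable (PiM {0..<Suc 0} (\<lambda>_. \<mu>))"
    by (rule measurable_compose[OF _ assms]) (simp add: measurable_component_singleton)
  from IT.nn_integral_lim_Suc[OF this] show ?thesis
    by (simp add: chain_def[symmetric] P_def prob_space.emeasure_space_1[OF prob_space_chain])
qed

text \<open>Induction over all test functions: one Markov step replaces \<open>f\<close> by its
  integral under the Doob kernel, and \<open>nn_integral_\<omega>_Suc\<close> matches this on the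
  right.\<close>

lemma nn_integral_chain:
  assumes [measurable]: "f \<in> borel_measurable \<mu>"
  shows "(\<integral>\<^sup>+xs. H (xs 0) * f (xs n) \<partial>chain) = (\<integral>\<^sup>+x. f x \<partial>\<omega> n)"
  using assms
proof (induction n arbitrary: f)
  case (0 f)
  note [measurable] = 0
  have "(\<integral>\<^sup>+x. f x \<partial>\<omega> 0) = (\<integral>\<^sup>+x. H x * f x \<partial>\<mu>)"
    unfolding \<omega>_def by (subst nn_integral_density) (auto simp: weight_def)
  then show ?case by (simp add: nn_integral_chain_0[of "\<lambda>x. H x * f x"])
next
  case (Suc n f)
  note [measurable] = Suc.prems
  let ?g = "\<lambda>u y. H (u 0) * f y"
  have g: "case_prod ?g \<in> borel_measurable (PiM {0..n} (\<lambda>_. \<mu>) \<Otimes>\<^sub>M \<mu>)"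
    by measurable
  have "(\<integral>\<^sup>+xs. H (xs 0) * f (xs (Suc n)) \<partial>chain) = (\<integral>\<^sup>+xs. \<integral>\<^sup>+y. H (xs 0) * f y \<partial>doob_kernel (xs n) \<partial>chain)"
    using nn_integral_chain_Suc[OF g] by simp
  also have "\<dots> = (\<integral>\<^sup>+xs. H (xs 0) * (\<integral>\<^sup>+y. f y \<partial>doob_kernel (xs n)) \<partial>chain)"
    by (intro nn_integral_cong nn_integral_cmult) (simp add: measurable_cong_sets[OF sets_doob_kernel refl] Suc.prems)
  also have "\<dots> = (\<integral>\<^sup>+x. \<integral>\<^sup>+y. f y \<partial>doob_kernel x \<partial>\<omega> n)"
    by (rule Suc.IH) measurable
  finally show ?case by (simp add: nn_integral_\<omega>_Suc)
qed

text \<open>Given the past, the next state is drawn from a law on the fibre of \<open>xs n\<close>,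
  so the measurable exceptional set \<open>D\<close> is hit with probability 0.\<close>

lemma AE_chain_fibre: "AE xs in chain. r (xs (Suc n)) = xs n"
proof -
  define D where "D = {p \<in> X \<times> X. r (snd p) \<noteq> fst p}"
  have D[measurable]: "D \<in> sets (\<mu> \<Otimes>\<^sub>M \<mu>)" unfolding D_def by (rule not_fibre_measurable)
  have "case_prod (\<lambda>u y. indicator D (u n, y) :: ennreal) \<in> borel_measurable (PiM {0..n} (\<lambda>_. \<mu>) \<Otimes>\<^sub>M \<mu>)"
    by measurable
  from nn_integral_chain_Suc[OF this]
  have "(\<integral>\<^sup>+xs. indicator D (xs n, xs (Suc n)) \<partial>chain) = (\<integral>\<^sup>+xs. \<integral>\<^sup>+y. indicator D (xs n, y) \<partial>doob_kernel (xs n) \<partial>chain)"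
    by simp
  also have "\<dots> = (\<integral>\<^sup>+xs. 0 \<partial>chain)"
  proof (rule nn_integral_cong)
    fix xs assume "xs \<in> space chain"
    then have x: "xs n \<in> X" by (simp add: space_chain)
    show "(\<integral>\<^sup>+y. indicator D (xs n, y) \<partial>doob_kernel (xs n)) = 0"
    proof (subst nn_integral_0_iff_AE)
      have "(\<lambda>y. indicator D (xs n, y) :: ennreal) \<in> borel_measurable \<mu>"
        using borel_measurable_indicator[OF sets_Pair1[OF D, of "xs n"]]
        by (simp add: indicator_def[abs_def] vimage_def)
      then show "(\<lambda>y. indicator D (xs n, y) :: ennreal) \<in> borel_measurable (doob_kernel (xs n))"
        by (simp add: measurable_cong_sets[OF sets_doob_kernel refl])
      show "AE y in doob_kernel (xs n). indicator D (xs n, y) = (0::ennreal)"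
        using AE_doob_kernel_fibre[OF x] by eventually_elim (auto simp: D_def)
    qed
  qed
  also have "\<dots> = 0" by simp
  finally have "AE xs in chain. indicator D (xs n, xs (Suc n)) = (0::ennreal)"
    by (subst (asm) nn_integral_0_iff_AE) auto
  with AE_space show ?thesis
    by eventually_elim (auto simp: D_def space_chain split: split_indicator_asm)
qed

lemma proj_limit_sets_chain: "proj_limit X r \<in> sets chain"
proof -
  have "proj_limit X r = {xs \<in> space chain. \<forall>n. (xs n, xs (Suc n)) \<notin> {p \<in> X \<times> X. r (snd p) \<noteq> fst p}}"
    by (auto simp: proj_limit_def space_chain)
  also have "\<dots> \<in> sets chain"
    using not_fibre_measurable by measurable
  finally show ?thesis .
qed

lemma AE_chain_proj_limit: "AE xs in chain. xs \<in> proj_limit X r"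
proof -
  have "AE xs in chain. \<forall>n. r (xs (Suc n)) = xs n"
    by (simp add: AE_all_countable AE_chain_fibre)
  with AE_space show ?thesis by eventually_elim (auto simp: proj_limit_def space_chain)
qed

text \<open>The image under the identity only replaces the trace of the product \<sigma>-algebra by
  the one generated by the cylinders.\<close>

definition path_measure :: "(nat \<Rightarrow> 'a) measure" where
  "path_measure = density
     (distr (restrict_space chain (proj_limit X r)) (proj_limit_algebra X r) (\<lambda>xs. xs))
     (\<lambda>xs. H (theta 0 xs))"

lemma sets_path_measure: "sets path_measure = sets (proj_limit_algebra X r)"
  by (simp add: path_measure_def)

lemma id_measurable_proj_limit:
  "(\<lambda>xs. xs) \<in> measurable (restrict_space chain (proj_limit X r)) (proj_limit_algebra X r)"
  unfolding proj_limit_algebra_def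
proof (rule measurable_measure_of)
  fix B assume "B \<in> {theta n -` E \<inter> proj_limit X r |n E. E \<in> sets (restrict_space borel X)}"
  then obtain n E where B: "B = theta n -` E \<inter> proj_limit X r" and E: "E \<in> sets \<mu>"
    by (auto simp: sets_\<mu>)
  have "B = ((\<lambda>xs. xs n) -` E \<inter> space chain) \<inter> proj_limit X r"
    by (auto simp: B theta_def space_chain proj_limit_def)
  moreover have "(\<lambda>xs. xs n) -` E \<inter> space chain \<in> sets chain"
    using measurable_sets[OF component_chain_measurable E] .
  ultimately show "(\<lambda>xs. xs) -` B \<inter> space (restrict_space chain (proj_limit X r)) \<in> sets (restrict_space chain (proj_limit X r))"
    by (auto simp: space_restrict_space sets_restrict_space Int_ac
        intro!: image_eqI[of _ _ "(\<lambda>xs. xs n) -` E \<inter> space chain"])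
qed (auto simp: space_restrict_space)

lemma distr_path_measure: "distr path_measure \<mu> (theta n) = \<omega> n"
proof (rule measure_eqI)
  fix A assume "A \<in> sets (distr path_measure \<mu> (theta n))"
  then have A[measurable]: "A \<in> sets \<mu>" by simp
  have [measurable]: "theta n \<in> measurable path_measure \<mu>"
    by (simp add: measurable_cong_sets[OF sets_path_measure refl])
  have "emeasure (distr path_measure \<mu> (theta n)) A = (\<integral>\<^sup>+xs. indicator A (theta n xs) \<partial>path_measure)"
    by (subst nn_integral_distr[of _ _ \<mu>, symmetric]) simp_all
  also have "\<dots> = (\<integral>\<^sup>+xs. H (theta 0 xs) * indicator A (theta n xs) \<partial>restrict_space chain (proj_limit X r))"
    unfolding path_measure_def
    by (subst nn_integral_density, simp, simp, subst nn_integral_distr[OF id_measurable_proj_limit]) simp_all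
  also have "\<dots> = (\<integral>\<^sup>+xs. H (xs 0) * indicator A (xs n) * indicator (proj_limit X r) xs \<partial>chain)"
    using proj_limit_sets_chain by (subst nn_integral_restrict_space) (auto simp: theta_def)
  \<comment> \<open>Restricting to the projective limit loses no mass, as almost every path lies in
    it.\<close>
  also have "\<dots> = (\<integral>\<^sup>+xs. H (xs 0) * indicator A (xs n) \<partial>chain)"
    using AE_chain_proj_limit by (intro nn_integral_cong_AE) auto
  also have "\<dots> = emeasure (\<omega> n) A"
    by (simp add: nn_integral_chain)
  finally show "emeasure (distr path_measure \<mu> (theta n)) A = emeasure (\<omega> n) A" .
qed simp

lemma integral_\<omega>:
  assumes "f \<in> Linfty \<mu>"
  shows "integrable (\<omega> n) f" "(\<integral>x. f x \<partial>\<omega> n) = omega X r \<mu> m0 h n f"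
proof -
  from assms obtain C where [measurable]: "f \<in> borel_measurable \<mu>" and C: "AE x in \<mu>. cmod (f x) \<le> C"
    by (auto simp: Linfty_def)
  have \<omega>: "\<omega> n = density \<mu> (\<lambda>x. ennreal (weight m0 n x * h x))"
    by (simp add: \<omega>_def H_def ennreal_mult' weight_nonneg)
  have nn: "AE x in \<mu>. 0 \<le> weight m0 n x * h x"
    using h_nonneg by eventually_elim (simp add: weight_nonneg)
  interpret finite_measure "\<omega> n" by (rule finite_\<omega>)
  \<comment> \<open>Absolute continuity of \<open>\<omega> n\<close> carries the essential bound
    over from \<mu>; finiteness of \<open>\<omega> n\<close> then gives integrability.\<close>
  have "AE x in \<omega> n. cmod (f x) \<le> C"
    unfolding \<omega>_def using C by (subst AE_density) auto
  then show i: "integrable (\<omega> n) f"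
    by (intro integrable_const_bound) (simp_all add: measurable_cong_sets[OF sets_\<omega> refl])
  have eq: "(weight m0 n x * h x) *\<^sub>R f x = weight m0 n x *\<^sub>R (f x * complex_of_real (h x))" for x
    by (simp add: scaleR_conv_of_real mult_ac)
  have "integrable \<mu> (\<lambda>x. (weight m0 n x * h x) *\<^sub>R f x)"
    using i nn unfolding \<omega> by (subst (asm) integrable_density) auto
  then show "(\<integral>x. f x \<partial>\<omega> n) = omega X r \<mu> m0 h n f"
    using nn unfolding \<omega> by (subst integral_density) (auto simp: eq omega_eq)
qed

lemma has_bochner_integral_path_measure:
  assumes "f \<in> Linfty \<mu>"
  shows "has_bochner_integral path_measure (\<lambda>xs. f (theta n xs)) (omega X r \<mu> m0 h n f)"
proof -
  have [measurable]: "f \<in> borel_measurable \<mu>" using assms by (simp add: Linfty_def)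
  have t: "theta n \<in> measurable path_measure \<mu>"
    by (simp add: measurable_cong_sets[OF sets_path_measure refl])
  show ?thesis
    using integral_\<omega>[OF assms, of n]
    by (simp add: has_bochner_integral_iff distr_path_measure[symmetric] integrable_distr_eq[OF t] integral_distr[OF t])
qed

end

theorem theorem5p3:
  fixes X :: "'a::metric_space set"
    and r :: "'a \<Rightarrow> 'a"
    and \<mu> :: "'a measure"
    and m0 :: "'a \<Rightarrow> complex"
    and h :: "'a \<Rightarrow> real"
  assumes "compact X"
    and "r \<in> measurable (restrict_space borel X) (restrict_space borel X)"
    and "r ` X = X"
    and "\<And>x. x \<in> X \<Longrightarrow> finite (fibre X r x)"
    and "sets \<mu> = sets (restrict_space borel X)"
    and "prob_space \<mu>"
    and "strongly_invariant X r \<mu>"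
    and "m0 \<in> Linfty \<mu>"
    and "integrable \<mu> h"
    and "AE x in \<mu>. 0 \<le> h x"
    and "AE x in \<mu>. transfer_op X r m0 h x = h x"
  shows "\<exists>!\<nu>. sets \<nu> = sets (proj_limit_algebra X r) \<and>
           (\<forall>n. \<forall>f \<in> Linfty \<mu>.
              has_bochner_integral \<nu> (\<lambda>xs. f (theta n xs)) (omega X r \<mu> m0 h n f))"
proof -
  interpret prob_space \<mu> by fact
  interpret harmonic_system X r \<mu> m0 h
    by unfold_locales (use assms in \<open>auto simp: Linfty_def\<close>)
  show ?thesis
  proof (rule ex1I[of _ path_measure])
    show "sets path_measure = sets (proj_limit_algebra X r) \<and>
       (\<forall>n. \<forall>f \<in> Linfty \<mu>.
          has_bochner_integral path_measure (\<lambda>xs. f (theta n xs)) (omega X r \<mu> m0 h n f))"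
      using sets_path_measure has_bochner_integral_path_measure by blast
  next
    fix \<nu>
    assume "sets \<nu> = sets (proj_limit_algebra X r) \<and>
       (\<forall>n. \<forall>f \<in> Linfty \<mu>. has_bochner_integral \<nu> (\<lambda>xs. f (theta n xs)) (omega X r \<mu> m0 h n f))"
    then show "\<nu> = path_measure"
      using sets_path_measure has_bochner_integral_path_measure
      by (intro proj_limit_measure_unique[where I="omega X r \<mu> m0 h"]) blast+
  qed
qed

end
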